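(* Let $\Bbbk$ be a field, $A$ a $\Bbbk$-algebra, and let $(\partial:A\to A^n,\sigma;\tilde\sigma,\bar\sigma,\hat\sigma;\pi)$ be a projectively free right twisted multi-derivation on $A$. Let $M$ be a finitely generated and projective left $A$-module with dual basis $\omega_i\in M$, $\eta_i\in{}_A\mathrm{Hom}(M,A)$, $i=1,\ldots,n$, such that $\pi_{ij}=\eta_j(\omega_i)$ for all $i,j$. Let $\Omega^1(A)=M$ be the associated first order differential calculus, that is, $M$ with right action $ma=\sum_{i,j}\eta_i(m)\sigma_{ij}(a)\omega_j$ and with differential $d:A\to M$, $da=\sum_i\partial_i(a)\omega_i$. For each $i=1,\ldots,n$ write $$\partial_i^\pi(a)=\sum_j\partial_j(a)\pi_{ji}\quad(a\in A),\qquad \partial_i^\sigma:=\sum_{j,k}\bar\sigma_{kj}\circ\partial_j^\pi\circ\hat\sigma_{ki},$$ and define $$\nabla:\mathrm{Hom}_A(\Omega^1(A),A)\to A,\qquad f\mapsto\sum_i\partial_i^\sigma\big(f(\omega_i)\big).$$ Then $\nabla$ is a divergence on $A$.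
   Context: All algebras are associative and unital over $\Bbbk$. ${}_A\mathrm{Hom}$ and $\mathrm{Hom}_A$ denote left, respectively right, $A$-module maps. For $\sigma:A\to M_n(A)$ write $\sigma(a)=(\sigma_{ij}(a))$, and for $\partial:A\to A^n$ write $\partial(a)=(\partial_i(a))$ (row vectors). Right twisted multi-derivation: a pair $(\partial,\sigma)$ of $\Bbbk$-linear maps $\partial:A\to A^n$, $\sigma:A\to M_n(A)$ with $\partial_i(ab)=\sum_j\partial_j(a)\sigma_{ji}(b)+a\partial_i(b)$ for all $a,b\in A$, $i=1,\ldots,n$. Pre-projective system on $A$: a triple $(\pi,\sigma,\tilde\sigma)$ with $\pi\in M_n(A)$ idempotent and $\sigma,\tilde\sigma:A\to M_n(A)$ $\Bbbk$-linear such that, for all $a,b\in A$, $\tilde\sigma(b)\sigma(a)\pi=\tilde\sigma(ba)\pi$, $\tilde\sigma(1)=\pi$, $\sigma(a)\pi=\pi\tilde\sigma(a)$. Projective system $(\pi,\sigma,\tilde\sigma;\bar\sigma)$: a pre-projective system together with an algebra map $\bar\sigma:A\to M_n(A)$ such that for all $a\in A$ and all $i,j$: $\sum_k\bar\sigma_{ik}(\tilde\sigma_{jk}(a))=\delta_{ij}a$ and $\sum_k\sigma_{kj}(\bar\sigma_{ki}(a))=a\pi_{ij}$. Projectively free right twisted multi-derivation $(\partial,\sigma;\tilde\sigma,\bar\sigma,\hat\sigma;\pi)$: a right twisted multi-derivation $(\partial,\sigma)$ together with a projective system $(\pi,\sigma,\tilde\sigma;\bar\sigma)$ and a $\Bbbk$-linear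 map $\hat\sigma:A\to M_n(A)$ such that for all $a\in A$ and all $i,j$: $\sum_k\hat\sigma_{ik}(\bar\sigma_{jk}(a))=\delta_{ij}a$ and $\sum_k\bar\sigma_{ki}(\hat\sigma_{kj}(a))=\delta_{ij}a$. A first order differential calculus on $A$ is an $A$-bimodule $\Omega^1(A)$ with a $\Bbbk$-linear map $d:A\to\Omega^1(A)$ satisfying $d(ab)=(da)b+a\,db$. The displayed right action makes $M$ an $A$-bimodule and $d$ satisfies the Leibniz rule. Divergence: a $\Bbbk$-linear map $\nabla:\mathrm{Hom}_A(\Omega^1(A),A)\to A$ with $\nabla(fa)=\nabla(f)a+f(da)$ for all $f\in\mathrm{Hom}_A(\Omega^1(A),A)$, $a\in A$, where $(fa)(\omega)=f(a\omega)$. *)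

theory Defs
  imports Complex_Main "Jordan_Normal_Form.Matrix"
begin

text \<open>
  A unital algebra over a field lives on a type of sort \<open>{ring, monoid_mult}\<close>; unlike
  \<open>ring_1\<close> this does not exclude the zero algebra. Matrices and row vectors over \<open>A\<close> are those
  of \<open>Jordan_Normal_Form\<close>, so the indices \<open>1, ..., n\<close> become \<open>0, ..., n - 1\<close>.
\<close>

locale k_algebra = vector_space scale
  for scale :: "'k::field \<Rightarrow> 'a::{ring,monoid_mult} \<Rightarrow> 'a" +
  assumes scale_mult_left: "scale c (a * b) = scale c a * b"
    and scale_mult_right: "scale c (a * b) = a * scale c b"

definition linear_to_vec ::
  "('k \<Rightarrow> 'a \<Rightarrow> 'a) \<Rightarrow> nat \<Rightarrow> ('a::ring \<Rightarrow> 'a vec) \<Rightarrow> bool" where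
  "linear_to_vec scale n F \<longleftrightarrow>
     (\<forall>a. F a \<in> carrier_vec n) \<and>
     (\<forall>a b. F (a + b) = F a + F b) \<and>
     (\<forall>c a. F (scale c a) = map_vec (scale c) (F a))"

definition linear_to_mat ::
  "('k \<Rightarrow> 'a \<Rightarrow> 'a) \<Rightarrow> nat \<Rightarrow> ('a::ring \<Rightarrow> 'a mat) \<Rightarrow> bool" where
  "linear_to_mat scale n F \<longleftrightarrow>
     (\<forall>a. F a \<in> carrier_mat n n) \<and>
     (\<forall>a b. F (a + b) = F a + F b) \<and>
     (\<forall>c a. F (scale c a) = map_mat (scale c) (F a))"

locale right_twisted_multi_derivation = k_algebra scale
  for scale :: "'k::field \<Rightarrow> 'a::{ring,monoid_mult} \<Rightarrow> 'a" +
  fixes n :: nat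
    and D :: "'a \<Rightarrow> 'a vec"
    and \<sigma> :: "'a \<Rightarrow> 'a mat"
  assumes D_linear: "linear_to_vec scale n D"
    and \<sigma>_linear: "linear_to_mat scale n \<sigma>"
    and D_mult: "i < n \<Longrightarrow>
      D (a * b) $ i = (\<Sum>j<n. D a $ j * \<sigma> b $$ (j, i)) + a * D b $ i"

locale pre_projective_system = k_algebra scale
  for scale :: "'k::field \<Rightarrow> 'a::{ring,monoid_mult} \<Rightarrow> 'a" +
  fixes n :: nat
    and \<pi> :: "'a mat"
    and \<sigma> \<sigma>t :: "'a \<Rightarrow> 'a mat"
  assumes \<pi>_carrier: "\<pi> \<in> carrier_mat n n"
    and \<pi>_idem: "\<pi> * \<pi> = \<pi>"
    and \<sigma>_linear: "linear_to_mat scale n \<sigma>"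
    and \<sigma>t_linear: "linear_to_mat scale n \<sigma>t"
    and \<sigma>t_mult: "\<sigma>t b * \<sigma> a * \<pi> = \<sigma>t (b * a) * \<pi>"
    and \<sigma>t_one: "\<sigma>t 1 = \<pi>"
    and \<sigma>_\<pi>: "\<sigma> a * \<pi> = \<pi> * \<sigma>t a"

locale projective_system = pre_projective_system scale n \<pi> \<sigma> \<sigma>t
  for scale :: "'k::field \<Rightarrow> 'a::{ring,monoid_mult} \<Rightarrow> 'a"
    and n :: nat
    and \<pi> :: "'a mat"
    and \<sigma> \<sigma>t :: "'a \<Rightarrow> 'a mat" +
  fixes \<sigma>b :: "'a \<Rightarrow> 'a mat"
  assumes \<sigma>b_linear: "linear_to_mat scale n \<sigma>b"
    and \<sigma>b_mult: "\<sigma>b (a * b) = \<sigma>b a * \<sigma>b b"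
    and \<sigma>b_one: "\<sigma>b 1 = 1\<^sub>m n"
    and \<sigma>b_\<sigma>t: "\<lbrakk>i < n; j < n\<rbrakk> \<Longrightarrow>
      (\<Sum>k<n. \<sigma>b (\<sigma>t a $$ (j, k)) $$ (i, k)) = (if i = j then a else 0)"
    and \<sigma>_\<sigma>b: "\<lbrakk>i < n; j < n\<rbrakk> \<Longrightarrow>
      (\<Sum>k<n. \<sigma> (\<sigma>b a $$ (k, i)) $$ (k, j)) = a * \<pi> $$ (i, j)"

locale projectively_free_right_twisted_multi_derivation =
  right_twisted_multi_derivation scale n D \<sigma> + projective_system scale n \<pi> \<sigma> \<sigma>t \<sigma>b
  for scale :: "'k::field \<Rightarrow> 'a::{ring,monoid_mult} \<Rightarrow> 'a"
    and n :: nat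
    and D :: "'a \<Rightarrow> 'a vec"
    and \<sigma> \<sigma>t \<sigma>b :: "'a \<Rightarrow> 'a mat"
    and \<pi> :: "'a mat" +
  fixes \<sigma>h :: "'a \<Rightarrow> 'a mat"
  assumes \<sigma>h_linear: "linear_to_mat scale n \<sigma>h"
    and \<sigma>h_\<sigma>b: "\<lbrakk>i < n; j < n\<rbrakk> \<Longrightarrow>
      (\<Sum>k<n. \<sigma>h (\<sigma>b a $$ (j, k)) $$ (i, k)) = (if i = j then a else 0)"
    and \<sigma>b_\<sigma>h: "\<lbrakk>i < n; j < n\<rbrakk> \<Longrightarrow>
      (\<Sum>k<n. \<sigma>b (\<sigma>h a $$ (k, j)) $$ (k, i)) = (if i = j then a else 0)"

text \<open>The library's \<open>module\<close> locale only covers commutative scalar rings.\<close>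

locale left_module =
  fixes lact :: "'a::{ring,monoid_mult} \<Rightarrow> 'm::ab_group_add \<Rightarrow> 'm"
  assumes lact_add_right: "lact a (x + y) = lact a x + lact a y"
    and lact_add_left: "lact (a + b) x = lact a x + lact b x"
    and lact_lact: "lact a (lact b x) = lact (a * b) x"
    and lact_one: "lact 1 x = x"

definition left_hom :: "('a::ring \<Rightarrow> 'm::ab_group_add \<Rightarrow> 'm) \<Rightarrow> ('m \<Rightarrow> 'a) set" where
  "left_hom lact =
     {f. (\<forall>x y. f (x + y) = f x + f y) \<and> (\<forall>a x. f (lact a x) = a * f x)}"

definition right_hom :: "('m::ab_group_add \<Rightarrow> 'a::ring \<Rightarrow> 'm) \<Rightarrow> ('m \<Rightarrow> 'a) set" where
  "right_hom ract =
     {f. (\<forall>x y. f (x + y) = f x + f y) \<and> (\<forall>x a. f (ract x a) = f x * a)}"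

text \<open>
  By the dual basis lemma, a left module has a finite dual basis if and only if it is finitely
  generated and projective.
\<close>

locale fg_projective_dual_basis = left_module lact
  for lact :: "'a::{ring,monoid_mult} \<Rightarrow> 'm::ab_group_add \<Rightarrow> 'm" +
  fixes n :: nat
    and \<omega> :: "nat \<Rightarrow> 'm"
    and \<eta> :: "nat \<Rightarrow> 'm \<Rightarrow> 'a"
  assumes \<eta>_left_hom: "i < n \<Longrightarrow> \<eta> i \<in> left_hom lact"
    and dual_basis: "m = (\<Sum>i<n. lact (\<eta> i m) (\<omega> i))"

text \<open>
  Bimodules are over the \<open>k\<close>-algebra \<open>A\<close>, so the two actions of \<open>k\<close> through \<open>k \<rightarrow> A\<close> agree.
\<close>

locale bimodule = k_algebra scale + left_module lact
  for scale :: "'k::field \<Rightarrow> 'a::{ring,monoid_mult} \<Rightarrow> 'a"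
    and lact :: "'a \<Rightarrow> 'm::ab_group_add \<Rightarrow> 'm" +
  fixes ract :: "'m \<Rightarrow> 'a \<Rightarrow> 'm"
  assumes ract_add_left: "ract (x + y) a = ract x a + ract y a"
    and ract_add_right: "ract x (a + b) = ract x a + ract x b"
    and ract_ract: "ract (ract x a) b = ract x (a * b)"
    and ract_one: "ract x 1 = x"
    and lact_ract: "ract (lact a x) b = lact a (ract x b)"
    and scalars_central: "lact (scale c 1) x = ract x (scale c 1)"

locale first_order_differential_calculus = bimodule scale lact ract
  for scale :: "'k::field \<Rightarrow> 'a::{ring,monoid_mult} \<Rightarrow> 'a"
    and lact :: "'a \<Rightarrow> 'm::ab_group_add \<Rightarrow> 'm"
    and ract :: "'m \<Rightarrow> 'a \<Rightarrow> 'm" +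
  fixes d :: "'a \<Rightarrow> 'm"
  assumes d_add: "d (a + b) = d a + d b"
    and d_scale: "d (scale c a) = lact (scale c 1) (d a)"
    and d_mult: "d (a * b) = ract (d a) b + lact a (d b)"

text \<open>
  \<open>nabla\<close> is a total function in HOL, but only its values on \<open>right_hom ract\<close> matter.
\<close>

locale divergence = first_order_differential_calculus scale lact ract d
  for scale :: "'k::field \<Rightarrow> 'a::{ring,monoid_mult} \<Rightarrow> 'a"
    and lact :: "'a \<Rightarrow> 'm::ab_group_add \<Rightarrow> 'm"
    and ract :: "'m \<Rightarrow> 'a \<Rightarrow> 'm"
    and d :: "'a \<Rightarrow> 'm" +
  fixes nabla :: "('m \<Rightarrow> 'a) \<Rightarrow> 'a"
  assumes nabla_add: "\<lbrakk>f \<in> right_hom ract; g \<in> right_hom ract\<rbrakk> \<Longrightarrow>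
      nabla (\<lambda>x. f x + g x) = nabla f + nabla g"
    and nabla_scale: "f \<in> right_hom ract \<Longrightarrow>
      nabla (\<lambda>x. scale c (f x)) = scale c (nabla f)"
    and nabla_mult: "f \<in> right_hom ract \<Longrightarrow>
      nabla (\<lambda>x. f (lact a x)) = nabla f * a + f (d a)"

definition calculus_ract ::
  "('a::ring \<Rightarrow> 'm::ab_group_add \<Rightarrow> 'm) \<Rightarrow> nat \<Rightarrow> (nat \<Rightarrow> 'm) \<Rightarrow> (nat \<Rightarrow> 'm \<Rightarrow> 'a) \<Rightarrow>
    ('a \<Rightarrow> 'a mat) \<Rightarrow> 'm \<Rightarrow> 'a \<Rightarrow> 'm" where
  "calculus_ract lact n \<omega> \<eta> \<sigma> m a =
     (\<Sum>i<n. \<Sum>j<n. lact (\<eta> i m * \<sigma> a $$ (i, j)) (\<omega> j))"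

definition calculus_d ::
  "('a::ring \<Rightarrow> 'm::ab_group_add \<Rightarrow> 'm) \<Rightarrow> nat \<Rightarrow> (nat \<Rightarrow> 'm) \<Rightarrow> ('a \<Rightarrow> 'a vec) \<Rightarrow>
    'a \<Rightarrow> 'm" where
  "calculus_d lact n \<omega> D a = (\<Sum>i<n. lact (D a $ i) (\<omega> i))"

definition D_pi :: "nat \<Rightarrow> ('a::ring \<Rightarrow> 'a vec) \<Rightarrow> 'a mat \<Rightarrow> nat \<Rightarrow> 'a \<Rightarrow> 'a" where
  "D_pi n D \<pi> i a = (\<Sum>j<n. D a $ j * \<pi> $$ (j, i))"

definition D_sigma ::
  "nat \<Rightarrow> ('a::ring \<Rightarrow> 'a vec) \<Rightarrow> 'a mat \<Rightarrow> ('a \<Rightarrow> 'a mat) \<Rightarrow> ('a \<Rightarrow> 'a mat) \<Rightarrow>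
    nat \<Rightarrow> 'a \<Rightarrow> 'a" where
  "D_sigma n D \<pi> \<sigma>b \<sigma>h i a =
     (\<Sum>j<n. \<Sum>k<n. \<sigma>b (D_pi n D \<pi> j (\<sigma>h a $$ (k, i))) $$ (k, j))"

end

theory Submission
  imports Defs
begin

text \<open>
  Everything is expressed through row vectors of coefficients. A row \<open>x\<close> over \<open>A\<close> stands for the
  element \<open>x\<omega> = \<Sum>\<^sub>i x\<^sub>i \<omega>\<^sub>i\<close> of \<open>M\<close>; since \<open>\<omega> = \<pi>\<omega>\<close>, the rows \<open>x\<close> and \<open>x\<pi>\<close> stand for the same
  element, so only identities multiplied by \<open>\<pi>\<close> on the right matter.

  \<^bold>\<open>The calculus.\<close> From \<open>\<sigma>(a)\<pi> = \<pi>\<sigma>t(a)\<close> one gets \<open>\<pi>\<sigma>(a)\<pi> = \<sigma>(a)\<pi>\<close>, and therefore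
  \<open>(x\<omega>)a = (x\<sigma>(a))\<omega>\<close> for every row \<open>x\<close>, not only for the row of coefficients \<open>\<eta>\<^sub>i(m)\<close>
  (lemma \<open>ract_lincomb\<close>). Associativity and unitality of the right action are then the matrix
  identities \<open>\<sigma>(a)\<sigma>(b)\<pi> = \<sigma>(ab)\<pi>\<close> and \<open>\<sigma>(1)\<pi> = \<pi>\<close>, and the Leibniz rule of \<open>d\<close> is the twisted Leibniz
  rule of the row \<open>\<partial>(a)\<close>.

  \<^bold>\<open>The divergence.\<close> The relation between \<open>\<sigma>\<close> and \<open>\<sigma>b\<close> says that left multiples of the generators
  can be written as right multiples, \<open>a\<omega>\<^sub>i = \<Sum>\<^sub>k \<omega>\<^sub>k \<sigma>b\<^sub>k\<^sub>i(a)\<close> (lemma \<open>lact_omega\<close>). Hence passing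
  from a right linear \<open>f\<close> to \<open>fa\<close> replaces the row \<open>w = (f(\<omega>\<^sub>i))\<close> by \<open>w \<sigma>b(a)\<close>. Let
  \<open>S(v)\<^sub>j = \<Sum>\<^sub>k \<sigma>b\<^sub>k\<^sub>j(v\<^sub>k)\<close> and \<open>T(w)\<^sub>i = \<Sum>\<^sub>k \<sigma>h\<^sub>i\<^sub>k(w\<^sub>k)\<close>; these operators on rows
  (\<open>bar_row\<close> and \<open>hat_row\<close>) are mutually inverse, and multiplicativity of \<open>\<sigma>b\<close> gives \<open>S(va) = S(v)\<sigma>b(a)\<close>, so
  \<open>T(w \<sigma>b(a)) = T(w)a\<close>. By additivity the divergence is
  \<open>\<nabla>(f) = \<Sum>\<^sub>j S(\<partial>\<^sup>\<pi>\<^sub>j(T(w)))\<^sub>j\<close>, so \<open>\<nabla>(fa)\<close> is the same expression with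
  \<open>T(w)\<close> replaced by \<open>T(w)a\<close>. The row \<open>\<partial>\<^sup>\<pi>\<close> satisfies the Leibniz rule twisted by \<open>\<sigma>t\<close>:
  in \<open>\<partial>\<^sup>\<pi>\<^sub>j(ga)\<close> the twisted term contributes \<open>\<nabla>(f)a\<close>, as \<open>\<sigma>b\<close> undoes \<open>\<sigma>t\<close>, while the term
  \<open>g \<partial>\<^sup>\<pi>\<^sub>j(a)\<close> contributes \<open>\<Sum>\<^sub>j (w \<sigma>b(\<partial>\<^sup>\<pi>\<^sub>j(a)))\<^sub>j = \<Sum>\<^sub>j f(\<partial>\<^sup>\<pi>\<^sub>j(a)\<omega>\<^sub>j) = f(da)\<close>.
\<close>

section \<open>Entries of linear matrix-valued maps and products of rows with matrices\<close>

lemma additive_sum: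
  fixes f :: "'b::ab_group_add \<Rightarrow> 'c::ab_group_add"
  assumes "\<And>x y. f (x + y) = f x + f y"
  shows "f (sum g I) = (\<Sum>i\<in>I. f (g i))"
  using assms by (intro additive.sum additive.intro)

context
  fixes scale :: "'k \<Rightarrow> 'a::ring \<Rightarrow> 'a" and n :: nat and F :: "'a \<Rightarrow> 'a mat"
  assumes F: "linear_to_mat scale n F"
begin

lemma linear_to_mat_carrier: "F a \<in> carrier_mat n n"
  using F by (simp add: linear_to_mat_def)

context
  fixes i j :: nat
  assumes ij: "i < n" "j < n"
begin

lemma linear_to_mat_add: "F (a + b) $$ (i, j) = F a $$ (i, j) + F b $$ (i, j)"
  using F ij by (simp add: linear_to_mat_def carrier_matD[OF linear_to_mat_carrier])

lemma linear_to_mat_scale: "F (scale c a) $$ (i, j) = scale c (F a $$ (i, j))"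
  using F ij by (simp add: linear_to_mat_def carrier_matD[OF linear_to_mat_carrier])

lemma linear_to_mat_sum: "F (sum g I) $$ (i, j) = (\<Sum>x\<in>I. F (g x) $$ (i, j))"
  by (rule additive_sum) (rule linear_to_mat_add)

end

end

definition row_mult :: "nat \<Rightarrow> (nat \<Rightarrow> 'a::ring) \<Rightarrow> 'a mat \<Rightarrow> nat \<Rightarrow> 'a" where
  "row_mult n x X j = (\<Sum>i<n. x i * X $$ (i, j))"

lemma index_mult_mat_sum:
  assumes "X \<in> carrier_mat n n" "Y \<in> carrier_mat n n" "i < n" "j < n"
  shows "(X * Y) $$ (i, j) = (\<Sum>k<n. X $$ (i, k) * Y $$ (k, j))"
  using assms by (auto simp: scalar_prod_def atLeast0LessThan intro!: sum.cong)

lemma row_mult_cong: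
  "(\<And>i. i < n \<Longrightarrow> x i = y i) \<Longrightarrow> row_mult n x X j = row_mult n y X j"
  by (simp add: row_mult_def)

lemma row_mult_mult:
  assumes "X \<in> carrier_mat n n" "Y \<in> carrier_mat n n" "j < n"
  shows "row_mult n (row_mult n x X) Y j = row_mult n x (X * Y) j"
proof -
  have "row_mult n x (X * Y) j = (\<Sum>i<n. \<Sum>k<n. x i * X $$ (i, k) * Y $$ (k, j))"
    using assms unfolding row_mult_def
    by (intro sum.cong refl) (simp add: index_mult_mat_sum sum_distrib_left mult.assoc del: index_mult_mat)
  also have "\<dots> = row_mult n (row_mult n x X) Y j"
    unfolding row_mult_def by (subst sum.swap) (simp add: sum_distrib_right)
  finally show ?thesis by simp
qed

lemma row_mult_unit:
  fixes X :: "'a::{ring,monoid_mult} mat"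
  assumes "k < n"
  shows "row_mult n (\<lambda>i. if i = k then 1 else 0) X j = X $$ (k, j)"
proof -
  have "row_mult n (\<lambda>i. if i = k then 1 else 0) X j
    = (\<Sum>i<n. if i = k then X $$ (i, j) else 0)"
    unfolding row_mult_def by (intro sum.cong) auto
  then show ?thesis using assms by simp
qed

section \<open>Matrix identities of a pre-projective system\<close>

context pre_projective_system
begin

lemmas mat_carriers [simp, intro] =
  \<pi>_carrier linear_to_mat_carrier[OF \<sigma>_linear] linear_to_mat_carrier[OF \<sigma>t_linear]

lemma square_mult_carrier [intro]:
  "\<lbrakk>X \<in> carrier_mat n n; Y \<in> carrier_mat n n\<rbrakk> \<Longrightarrow> X * Y \<in> carrier_mat n n"
  for X Y :: "'a mat"
  by (rule mult_carrier_mat)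

text \<open>
  The image of \<open>\<pi>\<close> is stable under \<open>\<sigma>(a)\<close>, because \<open>\<sigma>(a)\<pi> = \<pi>\<sigma>t(a)\<close> already factors through \<open>\<pi>\<close>.
\<close>

lemma \<pi>_\<sigma>_\<pi>: "\<pi> * (\<sigma> a * \<pi>) = \<sigma> a * \<pi>"
proof -
  have "\<pi> * (\<pi> * \<sigma>t a) = (\<pi> * \<pi>) * \<sigma>t a"
    by (rule assoc_mult_mat[symmetric]) auto
  then show ?thesis by (simp add: \<sigma>_\<pi> \<pi>_idem)
qed

lemma \<sigma>_one_\<pi>: "\<sigma> 1 * \<pi> = \<pi>"
  by (simp add: \<sigma>_\<pi> \<sigma>t_one \<pi>_idem)

text \<open>
  The map \<open>\<sigma>\<close> is multiplicative modulo \<open>\<pi>\<close>: a copy of \<open>\<pi>\<close> can be inserted between the two factors,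
  which turns \<open>\<sigma>(a)\<close> into \<open>\<sigma>t(a)\<close> and makes the twisted multiplicativity of \<open>\<sigma>t\<close> applicable.
\<close>

lemma \<sigma>_mult_\<pi>: "\<sigma> a * \<sigma> b * \<pi> = \<sigma> (a * b) * \<pi>"
proof -
  note assoc = assoc_mult_mat[where ?n\<^sub>1.0 = n and ?n\<^sub>2.0 = n and ?n\<^sub>3.0 = n and ?n\<^sub>4.0 = n]
  have "\<sigma> a * \<sigma> b * \<pi> = \<sigma> a * (\<pi> * (\<sigma> b * \<pi>))"
    unfolding \<pi>_\<sigma>_\<pi> by (rule assoc) auto
  also have "\<dots> = (\<sigma> a * \<pi>) * (\<sigma> b * \<pi>)"
    by (rule assoc[symmetric]) auto
  also have "\<dots> = \<pi> * (\<sigma>t a * (\<sigma> b * \<pi>))"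
    unfolding \<sigma>_\<pi>[of a] by (rule assoc) auto
  also have "\<sigma>t a * (\<sigma> b * \<pi>) = \<sigma>t (a * b) * \<pi>"
    unfolding \<sigma>t_mult[symmetric] by (rule assoc[symmetric]) auto
  also have "\<pi> * (\<sigma>t (a * b) * \<pi>) = (\<sigma> (a * b) * \<pi>) * \<pi>"
    unfolding \<sigma>_\<pi> by (rule assoc[symmetric]) auto
  also have "\<dots> = \<sigma> (a * b) * (\<pi> * \<pi>)"
    by (rule assoc) auto
  finally show ?thesis by (simp add: \<pi>_idem)
qed

end

section \<open>The divergence on rows\<close>

context projectively_free_right_twisted_multi_derivation
begin

definition bar_row :: "(nat \<Rightarrow> 'a) \<Rightarrow> nat \<Rightarrow> 'a" where
  "bar_row v j = (\<Sum>k<n. \<sigma>b (v k) $$ (k, j))"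

definition hat_row :: "(nat \<Rightarrow> 'a) \<Rightarrow> nat \<Rightarrow> 'a" where
  "hat_row w i = (\<Sum>k<n. \<sigma>h (w k) $$ (i, k))"

lemma bar_row_cong: "(\<And>k. k < n \<Longrightarrow> v k = w k) \<Longrightarrow> bar_row v j = bar_row w j"
  by (simp add: bar_row_def)

lemma hat_row_cong: "(\<And>k. k < n \<Longrightarrow> v k = w k) \<Longrightarrow> hat_row v j = hat_row w j"
  by (simp add: hat_row_def)

lemma bar_row_sum:
  "j < n \<Longrightarrow> bar_row (\<lambda>k. \<Sum>l\<in>I. v l k) j = (\<Sum>l\<in>I. bar_row (v l) j)"
  unfolding bar_row_def by (subst sum.swap) (simp add: linear_to_mat_sum[OF \<sigma>b_linear])

lemma bar_row_add: "j < n \<Longrightarrow> bar_row (\<lambda>k. v k + w k) j = bar_row v j + bar_row w j"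
  by (simp add: bar_row_def linear_to_mat_add[OF \<sigma>b_linear] sum.distrib)

lemma bar_row_scale: "j < n \<Longrightarrow> bar_row (\<lambda>k. scale c (v k)) j = scale c (bar_row v j)"
  by (simp add: bar_row_def linear_to_mat_scale[OF \<sigma>b_linear] scale_sum_right)

lemma hat_row_add: "j < n \<Longrightarrow> hat_row (\<lambda>k. v k + w k) j = hat_row v j + hat_row w j"
  by (simp add: hat_row_def linear_to_mat_add[OF \<sigma>h_linear] sum.distrib)

lemma hat_row_scale: "j < n \<Longrightarrow> hat_row (\<lambda>k. scale c (v k)) j = scale c (hat_row v j)"
  by (simp add: hat_row_def linear_to_mat_scale[OF \<sigma>h_linear] scale_sum_right)

lemma hat_bar_row:
  assumes "i < n"
  shows "hat_row (bar_row v) i = v i"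
proof -
  have "hat_row (bar_row v) i = (\<Sum>k<n. \<Sum>j<n. \<sigma>h (\<sigma>b (v j) $$ (j, k)) $$ (i, k))"
    using assms by (simp add: hat_row_def bar_row_def linear_to_mat_sum[OF \<sigma>h_linear])
  also have "\<dots> = (\<Sum>j<n. \<Sum>k<n. \<sigma>h (\<sigma>b (v j) $$ (j, k)) $$ (i, k))"
    by (rule sum.swap)
  also have "\<dots> = v i"
    using assms by (simp add: \<sigma>h_\<sigma>b)
  finally show ?thesis .
qed

lemma bar_hat_row:
  assumes "i < n"
  shows "bar_row (hat_row w) i = w i"
proof -
  have "bar_row (hat_row w) i = (\<Sum>k<n. \<Sum>j<n. \<sigma>b (\<sigma>h (w j) $$ (k, j)) $$ (k, i))"
    using assms by (simp add: hat_row_def bar_row_def linear_to_mat_sum[OF \<sigma>b_linear])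
  also have "\<dots> = (\<Sum>j<n. \<Sum>k<n. \<sigma>b (\<sigma>h (w j) $$ (k, j)) $$ (k, i))"
    by (rule sum.swap)
  also have "\<dots> = w i"
    using assms by (simp add: \<sigma>b_\<sigma>h)
  finally show ?thesis .
qed

lemma bar_row_mult:
  assumes "j < n"
  shows "bar_row (\<lambda>k. v k * a) j = row_mult n (bar_row v) (\<sigma>b a) j"
proof -
  have "bar_row (\<lambda>k. v k * a) j = (\<Sum>k<n. \<Sum>m<n. \<sigma>b (v k) $$ (k, m) * \<sigma>b a $$ (m, j))"
    using assms by (simp add: bar_row_def \<sigma>b_mult
        index_mult_mat_sum[OF linear_to_mat_carrier[OF \<sigma>b_linear]
          linear_to_mat_carrier[OF \<sigma>b_linear]])
  then show ?thesis
    unfolding row_mult_def bar_row_def by (subst (asm) sum.swap) (simp add: sum_distrib_right)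
qed

text \<open>
  Inverse to the rule for \<open>bar_row\<close>: write \<open>w\<close> as \<open>bar_row\<close> of \<open>hat_row w\<close>, so that \<open>\<sigma>b(a)\<close> can be
  absorbed into the argument.
\<close>

lemma hat_row_mult:
  assumes "i < n"
  shows "hat_row (row_mult n w (\<sigma>b a)) i = hat_row w i * a"
proof -
  have "hat_row (row_mult n w (\<sigma>b a)) i = hat_row (bar_row (\<lambda>k. hat_row w k * a)) i"
    by (intro hat_row_cong) (simp add: bar_row_mult bar_hat_row cong: row_mult_cong)
  then show ?thesis using assms by (simp add: hat_bar_row)
qed

lemma D_add: "i < n \<Longrightarrow> D (a + b) $ i = D a $ i + D b $ i"
  using D_linear by (metis carrier_vecD index_add_vec(1) linear_to_vec_def)

lemma D_scale: "i < n \<Longrightarrow> D (scale c a) $ i = scale c (D a $ i)"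
  using D_linear by (metis carrier_vecD index_map_vec(1) linear_to_vec_def)

lemma D_pi_add: "D_pi n D \<pi> j (a + b) = D_pi n D \<pi> j a + D_pi n D \<pi> j b"
  by (simp add: D_pi_def D_add distrib_right sum.distrib)

lemma D_pi_scale: "D_pi n D \<pi> j (scale c a) = scale c (D_pi n D \<pi> j a)"
  by (simp add: D_pi_def D_scale scale_sum_right scale_mult_left)

lemma D_pi_row_mult: "D_pi n D \<pi> j a = row_mult n (\<lambda>i. D a $ i) \<pi> j"
  by (simp add: D_pi_def row_mult_def)

text \<open>
  Multiplying the Leibniz rule by \<open>\<pi>\<close> moves \<open>\<pi>\<close> past \<open>\<sigma>(b)\<close> and so trades \<open>\<sigma>\<close> for \<open>\<sigma>t\<close>, the map that
  \<open>\<sigma>b\<close> inverts.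
\<close>

lemma D_pi_mult:
  assumes "j < n"
  shows "D_pi n D \<pi> j (a * b) = row_mult n (\<lambda>l. D_pi n D \<pi> l a) (\<sigma>t b) j + a * D_pi n D \<pi> j b"
proof -
  have "D_pi n D \<pi> j (a * b)
    = row_mult n (row_mult n (\<lambda>i. D a $ i) (\<sigma> b)) \<pi> j + a * D_pi n D \<pi> j b"
    by (simp add: D_pi_def row_mult_def D_mult distrib_right sum.distrib sum_distrib_left
        mult.assoc)
  also have "row_mult n (row_mult n (\<lambda>i. D a $ i) (\<sigma> b)) \<pi> j
    = row_mult n (row_mult n (\<lambda>i. D a $ i) \<pi>) (\<sigma>t b) j"
    using assms by (simp add: row_mult_mult \<sigma>_\<pi>)
  finally show ?thesis by (simp add: D_pi_row_mult[abs_def])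
qed

definition row_div :: "(nat \<Rightarrow> 'a) \<Rightarrow> 'a" where
  "row_div w = (\<Sum>j<n. bar_row (\<lambda>k. D_pi n D \<pi> j (hat_row w k)) j)"

lemma sum_D_sigma: "(\<Sum>i<n. D_sigma n D \<pi> \<sigma>b \<sigma>h i (w i)) = row_div w"
proof -
  have "row_div w
    = (\<Sum>j<n. \<Sum>k<n. \<Sum>i<n. \<sigma>b (D_pi n D \<pi> j (\<sigma>h (w i) $$ (k, i))) $$ (k, j))"
    by (simp add: row_div_def bar_row_def hat_row_def additive_sum[of "D_pi n D \<pi> _", OF D_pi_add]
        linear_to_mat_sum[OF \<sigma>b_linear])
  also have "\<dots>
    = (\<Sum>j<n. \<Sum>i<n. \<Sum>k<n. \<sigma>b (D_pi n D \<pi> j (\<sigma>h (w i) $$ (k, i))) $$ (k, j))"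
    by (intro sum.cong refl sum.swap)
  also have "\<dots> = (\<Sum>i<n. D_sigma n D \<pi> \<sigma>b \<sigma>h i (w i))"
    unfolding D_sigma_def by (rule sum.swap)
  finally show ?thesis ..
qed

lemma row_div_add: "row_div (\<lambda>k. v k + w k) = row_div v + row_div w"
  by (simp add: row_div_def hat_row_add D_pi_add bar_row_add sum.distrib cong: bar_row_cong)

lemma row_div_scale: "row_div (\<lambda>k. scale c (w k)) = scale c (row_div w)"
  by (simp add: row_div_def hat_row_scale D_pi_scale bar_row_scale scale_sum_right
      cong: bar_row_cong)

text \<open>
  This is the divergence property, with \<open>f\<close> replaced by its row of values on the generators. Passing
  to \<open>hat_row\<close> turns the twisted action of \<open>a\<close> on rows into plain right multiplication, to which the
  Leibniz rule applies; \<open>bar_row\<close> then returns \<open>\<nabla>(f)a\<close> from the twisted term and cancels \<open>hat_row\<close>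
  in the other one.
\<close>

lemma row_div_mult:
  "row_div (row_mult n w (\<sigma>b a)) = row_div w * a + (\<Sum>j<n. row_mult n w (\<sigma>b (D_pi n D \<pi> j a)) j)"
proof -
  define g where "g = hat_row w"
  define u where "u l = bar_row (\<lambda>k. D_pi n D \<pi> l (g k))" for l
  have "row_div (row_mult n w (\<sigma>b a)) = (\<Sum>j<n. bar_row (\<lambda>k. D_pi n D \<pi> j (g k * a)) j)"
    unfolding row_div_def g_def
    by (intro sum.cong refl bar_row_cong) (simp add: hat_row_mult)
  also have "\<dots> = (\<Sum>j<n. bar_row (\<lambda>k. \<Sum>l<n. D_pi n D \<pi> l (g k) * \<sigma>t a $$ (l, j)) j)
      + (\<Sum>j<n. bar_row (\<lambda>k. g k * D_pi n D \<pi> j a) j)"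
    by (simp add: D_pi_mult row_mult_def bar_row_add sum.distrib)
  also have "(\<Sum>j<n. bar_row (\<lambda>k. g k * D_pi n D \<pi> j a) j)
      = (\<Sum>j<n. row_mult n w (\<sigma>b (D_pi n D \<pi> j a)) j)"
    by (simp add: bar_row_mult g_def bar_hat_row cong: row_mult_cong)
  also have "(\<Sum>j<n. bar_row (\<lambda>k. \<Sum>l<n. D_pi n D \<pi> l (g k) * \<sigma>t a $$ (l, j)) j)
      = (\<Sum>j<n. \<Sum>l<n. \<Sum>m<n. u l m * \<sigma>b (\<sigma>t a $$ (l, j)) $$ (m, j))"
    by (simp add: bar_row_sum bar_row_mult u_def row_mult_def)
  also have "\<dots> = (\<Sum>l<n. \<Sum>j<n. \<Sum>m<n. u l m * \<sigma>b (\<sigma>t a $$ (l, j)) $$ (m, j))"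
    by (rule sum.swap)
  also have "\<dots> = (\<Sum>l<n. \<Sum>m<n. \<Sum>j<n. u l m * \<sigma>b (\<sigma>t a $$ (l, j)) $$ (m, j))"
    by (intro sum.cong refl sum.swap)
  also have "\<dots> = (\<Sum>l<n. \<Sum>m<n. if m = l then u l m * a else 0)"
    by (intro sum.cong refl) (simp add: sum_distrib_left[symmetric] \<sigma>b_\<sigma>t)
  also have "\<dots> = row_div w * a"
    by (simp add: row_div_def u_def g_def sum_distrib_right)
  finally show ?thesis .
qed

end

section \<open>The calculus on a module with a dual basis\<close>

context left_module
begin

lemma lact_zero_left: "lact 0 x = 0"
  using lact_add_left[of 0 0 x] by simp

lemma lact_sum_left: "lact (sum g I) x = (\<Sum>i\<in>I. lact (g i) x)"
  by (rule additive_sum[of "\<lambda>a. lact a x"]) (rule lact_add_left)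

lemma lact_sum_right: "lact a (sum g I) = (\<Sum>i\<in>I. lact a (g i))"
  by (rule additive_sum) (rule lact_add_right)

end

context fg_projective_dual_basis
begin

definition lincomb :: "(nat \<Rightarrow> 'a) \<Rightarrow> 'm" where
  "lincomb x = (\<Sum>i<n. lact (x i) (\<omega> i))"

lemma lincomb_cong: "(\<And>i. i < n \<Longrightarrow> x i = y i) \<Longrightarrow> lincomb x = lincomb y"
  by (simp add: lincomb_def)

lemma lincomb_add: "lincomb (\<lambda>i. x i + y i) = lincomb x + lincomb y"
  by (simp add: lincomb_def lact_add_left sum.distrib)

lemma lincomb_lact: "lact a (lincomb x) = lincomb (\<lambda>i. a * x i)"
  by (simp add: lincomb_def lact_sum_right lact_lact)

lemma lincomb_sum: "lincomb (\<lambda>i. \<Sum>k\<in>I. x k i) = (\<Sum>k\<in>I. lincomb (x k))"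
  unfolding lincomb_def by (subst sum.swap) (simp add: lact_sum_left)

lemma lincomb_coeffs: "lincomb (\<lambda>i. \<eta> i m) = m"
  using dual_basis[of m] by (simp add: lincomb_def)

lemma lincomb_unit:
  assumes "k < n"
  shows "lincomb (\<lambda>i. if i = k then 1 else 0) = \<omega> k"
proof -
  have "lincomb (\<lambda>i. if i = k then 1 else 0) = (\<Sum>i<n. if i = k then \<omega> i else 0)"
    unfolding lincomb_def by (intro sum.cong) (auto simp: lact_one lact_zero_left)
  then show ?thesis using assms by simp
qed

lemma calculus_ract_lincomb:
  "calculus_ract lact n \<omega> \<eta> s m a = lincomb (row_mult n (\<lambda>i. \<eta> i m) (s a))"
  unfolding calculus_ract_def lincomb_def row_mult_def lact_sum_left by (rule sum.swap)

lemma calculus_d_lincomb: "calculus_d lact n \<omega> D a = lincomb (\<lambda>i. D a $ i)"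
  by (simp add: calculus_d_def lincomb_def)

end

locale projectively_free_calculus =
  projectively_free_right_twisted_multi_derivation scale n D \<sigma> \<sigma>t \<sigma>b \<pi> \<sigma>h +
  fg_projective_dual_basis lact n \<omega> \<eta>
  for scale :: "'k::field \<Rightarrow> 'a::{ring,monoid_mult} \<Rightarrow> 'a"
    and n :: nat
    and D :: "'a \<Rightarrow> 'a vec"
    and \<sigma> \<sigma>t \<sigma>b \<sigma>h :: "'a \<Rightarrow> 'a mat"
    and \<pi> :: "'a mat"
    and lact :: "'a \<Rightarrow> 'm::ab_group_add \<Rightarrow> 'm"
    and \<omega> :: "nat \<Rightarrow> 'm"
    and \<eta> :: "nat \<Rightarrow> 'm \<Rightarrow> 'a" +
  assumes \<pi>_\<eta>: "\<lbrakk>i < n; j < n\<rbrakk> \<Longrightarrow> \<pi> $$ (i, j) = \<eta> j (\<omega> i)"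
begin

abbreviation ract :: "'m \<Rightarrow> 'a \<Rightarrow> 'm" where
  "ract \<equiv> calculus_ract lact n \<omega> \<eta> \<sigma>"

abbreviation d :: "'a \<Rightarrow> 'm" where
  "d \<equiv> calculus_d lact n \<omega> D"

lemma \<eta>_add: "k < n \<Longrightarrow> \<eta> k (x + y) = \<eta> k x + \<eta> k y"
  and \<eta>_lact: "k < n \<Longrightarrow> \<eta> k (lact a x) = a * \<eta> k x"
  using \<eta>_left_hom[of k] by (simp_all add: left_hom_def)

lemma \<eta>_lincomb:
  assumes "k < n"
  shows "\<eta> k (lincomb x) = row_mult n x \<pi> k"
  using assms
  by (simp add: lincomb_def row_mult_def additive_sum[of "\<eta> k", OF \<eta>_add] \<eta>_lact \<pi>_\<eta>)

lemma lincomb_\<pi>: "lincomb (row_mult n x \<pi>) = lincomb x"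
proof -
  have "lincomb (row_mult n x \<pi>) = lincomb (\<lambda>k. \<eta> k (lincomb x))"
    by (rule lincomb_cong) (simp add: \<eta>_lincomb)
  then show ?thesis by (simp add: lincomb_coeffs)
qed

text \<open>Since \<open>\<pi>\<omega> = \<omega>\<close>, matrix identities are needed only after multiplication by \<open>\<pi>\<close>.\<close>

lemma lincomb_row_mult_cong:
  assumes "X \<in> carrier_mat n n" "Y \<in> carrier_mat n n" "X * \<pi> = Y * \<pi>"
  shows "lincomb (row_mult n x X) = lincomb (row_mult n x Y)"
proof -
  have "lincomb (row_mult n (row_mult n x X) \<pi>) = lincomb (row_mult n (row_mult n x Y) \<pi>)"
    using assms by (intro lincomb_cong) (simp add: row_mult_mult)
  then show ?thesis by (simp add: lincomb_\<pi>)
qed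

text \<open>
  The action is defined through the coefficients \<open>\<eta>\<^sub>i(m)\<close>, which differ from a given row \<open>x\<close>
  representing \<open>m\<close> by a factor \<open>\<pi>\<close>; that factor is absorbed since \<open>\<pi>\<sigma>(a)\<pi> = \<sigma>(a)\<pi>\<close>.
\<close>

lemma ract_lincomb: "ract (lincomb x) a = lincomb (row_mult n x (\<sigma> a))"
proof -
  have "ract (lincomb x) a = lincomb (row_mult n (row_mult n x \<pi>) (\<sigma> a))"
    unfolding calculus_ract_lincomb
    by (intro lincomb_cong row_mult_cong) (rule \<eta>_lincomb)
  also have "\<dots> = lincomb (row_mult n x (\<pi> * \<sigma> a))"
    by (rule lincomb_cong) (simp add: row_mult_mult)
  also have "\<dots> = lincomb (row_mult n x (\<sigma> a))"
  proof (rule lincomb_row_mult_cong)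
    have "\<pi> * \<sigma> a * \<pi> = \<pi> * (\<sigma> a * \<pi>)"
      by (rule assoc_mult_mat) auto
    then show "\<pi> * \<sigma> a * \<pi> = \<sigma> a * \<pi>" by (simp add: \<pi>_\<sigma>_\<pi>)
  qed auto
  finally show ?thesis .
qed

lemma is_bimodule: "bimodule scale lact ract"
proof
  fix x y :: 'm and a b :: 'a and c :: 'k
  show "ract (x + y) a = ract x a + ract y a"
  proof -
    have "row_mult n (\<lambda>i. \<eta> i (x + y)) (\<sigma> a)
      = (\<lambda>j. row_mult n (\<lambda>i. \<eta> i x) (\<sigma> a) j + row_mult n (\<lambda>i. \<eta> i y) (\<sigma> a) j)"
      by (rule ext) (simp add: row_mult_def \<eta>_add distrib_right sum.distrib)
    then show ?thesis by (simp add: calculus_ract_lincomb lincomb_add)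
  qed
  show "ract x (a + b) = ract x a + ract x b"
    unfolding calculus_ract_lincomb lincomb_add[symmetric]
    by (rule lincomb_cong)
      (simp add: row_mult_def linear_to_mat_add[OF \<sigma>_linear] distrib_left sum.distrib)
  show "ract (ract x a) b = ract x (a * b)"
  proof -
    have "ract (ract x a) b = lincomb (row_mult n (\<lambda>i. \<eta> i x) (\<sigma> a * \<sigma> b))"
      unfolding calculus_ract_lincomb[of _ x a] ract_lincomb
      by (rule lincomb_cong) (simp add: row_mult_mult)
    also have "\<dots> = ract x (a * b)"
      unfolding calculus_ract_lincomb
      by (rule lincomb_row_mult_cong) (auto simp: \<sigma>_mult_\<pi>)
    finally show ?thesis .
  qed
  show "ract x 1 = x"
  proof -
    have "ract x 1 = lincomb (row_mult n (\<lambda>i. \<eta> i x) \<pi>)"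
      unfolding calculus_ract_lincomb
      by (rule lincomb_row_mult_cong) (auto simp: \<sigma>_one_\<pi> \<pi>_idem)
    then show ?thesis by (simp add: lincomb_\<pi> lincomb_coeffs)
  qed
  then have one: "lincomb (row_mult n (\<lambda>i. \<eta> i x) (\<sigma> 1)) = x"
    by (simp add: calculus_ract_lincomb)
  show "ract (lact a x) b = lact a (ract x b)"
    unfolding calculus_ract_lincomb lincomb_lact
    by (rule lincomb_cong) (simp add: row_mult_def \<eta>_lact sum_distrib_left mult.assoc)
  have "ract x (scale c 1) = lincomb (\<lambda>j. scale c 1 * row_mult n (\<lambda>i. \<eta> i x) (\<sigma> 1) j)"
    unfolding calculus_ract_lincomb
    by (rule lincomb_cong)
      (simp add: row_mult_def linear_to_mat_scale[OF \<sigma>_linear] scale_mult_left[symmetric]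
        scale_mult_right[symmetric] scale_sum_right)
  then show "lact (scale c 1) x = ract x (scale c 1)"
    by (simp add: lincomb_lact[symmetric] one)
qed

lemma is_first_order_differential_calculus:
  "first_order_differential_calculus scale lact ract d"
proof -
  interpret bimodule scale lact ract by (rule is_bimodule)
  show ?thesis
  proof
    fix a b :: 'a and c :: 'k
    show "d (a + b) = d a + d b"
      by (simp add: calculus_d_lincomb lincomb_add[symmetric] D_add cong: lincomb_cong)
    have "D (scale c a) $ i = scale c 1 * D a $ i" if "i < n" for i
      using that by (simp add: D_scale scale_mult_left[symmetric])
    then show "d (scale c a) = lact (scale c 1) (d a)"
      by (simp add: calculus_d_lincomb lincomb_lact cong: lincomb_cong)
    show "d (a * b) = ract (d a) b + lact a (d b)"
      unfolding calculus_d_lincomb ract_lincomb lincomb_lact lincomb_add[symmetric]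
      by (rule lincomb_cong) (simp add: D_mult row_mult_def)
  qed
qed

lemma d_lincomb_D_pi: "d a = lincomb (\<lambda>j. D_pi n D \<pi> j a)"
  by (simp add: calculus_d_lincomb D_pi_row_mult lincomb_\<pi>)

text \<open>
  The relation between \<open>\<sigma>\<close> and \<open>\<sigma>b\<close> in a projective system makes the generators on the left also
  generators on the right.
\<close>

lemma lact_omega:
  assumes "i < n"
  shows "lact a (\<omega> i) = (\<Sum>k<n. ract (\<omega> k) (\<sigma>b a $$ (k, i)))"
proof -
  have "ract (\<omega> k) b = lincomb (\<lambda>j. \<sigma> b $$ (k, j))" if "k < n" for k b
    using ract_lincomb[of "\<lambda>i. if i = k then 1 else 0" b] that
    by (simp add: lincomb_unit row_mult_unit cong: lincomb_cong)
  then have "(\<Sum>k<n. ract (\<omega> k) (\<sigma>b a $$ (k, i)))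
    = lincomb (\<lambda>j. \<Sum>k<n. \<sigma> (\<sigma>b a $$ (k, i)) $$ (k, j))"
    by (simp add: lincomb_sum)
  also have "\<dots> = lincomb (\<lambda>j. a * \<pi> $$ (i, j))"
    using assms by (intro lincomb_cong) (simp add: \<sigma>_\<sigma>b)
  also have "\<dots> = lact a (lincomb (\<lambda>j. \<eta> j (\<omega> i)))"
    using assms by (simp add: lincomb_lact \<pi>_\<eta> cong: lincomb_cong)
  finally show ?thesis by (simp add: lincomb_coeffs)
qed

context
  fixes f :: "'m \<Rightarrow> 'a"
  assumes f: "f \<in> right_hom ract"
begin

lemma right_hom_sum: "f (sum g I) = (\<Sum>i\<in>I. f (g i))"
  using f by (intro additive_sum) (simp add: right_hom_def)

lemma right_hom_lact_omega:
  assumes "i < n"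
  shows "f (lact a (\<omega> i)) = row_mult n (\<lambda>k. f (\<omega> k)) (\<sigma>b a) i"
proof -
  have "f (ract x b) = f x * b" for x b
    using f by (simp add: right_hom_def)
  then show ?thesis
    using assms by (simp add: lact_omega right_hom_sum row_mult_def)
qed

lemma row_div_right_hom_mult:
  "row_div (\<lambda>i. f (lact a (\<omega> i))) = row_div (\<lambda>i. f (\<omega> i)) * a + f (d a)"
proof -
  have "row_div (\<lambda>i. f (lact a (\<omega> i))) = row_div (row_mult n (\<lambda>k. f (\<omega> k)) (\<sigma>b a))"
    by (simp add: row_div_def right_hom_lact_omega cong: hat_row_cong)
  also have "\<dots> = row_div (\<lambda>i. f (\<omega> i)) * a
      + (\<Sum>j<n. row_mult n (\<lambda>k. f (\<omega> k)) (\<sigma>b (D_pi n D \<pi> j a)) j)"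
    by (rule row_div_mult)
  also have "(\<Sum>j<n. row_mult n (\<lambda>k. f (\<omega> k)) (\<sigma>b (D_pi n D \<pi> j a)) j) = f (d a)"
    by (simp add: d_lincomb_D_pi lincomb_def right_hom_sum right_hom_lact_omega)
  finally show ?thesis .
qed

end

end

section \<open>The divergence of the calculus\<close>

theorem theorem2p10:
  fixes scale :: "'k::field \<Rightarrow> 'a::{ring,monoid_mult} \<Rightarrow> 'a"
    and n :: nat
    and D :: "'a \<Rightarrow> 'a vec"
    and \<sigma> \<sigma>t \<sigma>b \<sigma>h :: "'a \<Rightarrow> 'a mat"
    and \<pi> :: "'a mat"
    and lact :: "'a \<Rightarrow> 'm::ab_group_add \<Rightarrow> 'm"
    and \<omega> :: "nat \<Rightarrow> 'm"
    and \<eta> :: "nat \<Rightarrow> 'm \<Rightarrow> 'a"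
  assumes "projectively_free_right_twisted_multi_derivation scale n D \<sigma> \<sigma>t \<sigma>b \<pi> \<sigma>h"
    and "fg_projective_dual_basis lact n \<omega> \<eta>"
    and "\<And>i j. i < n \<Longrightarrow> j < n \<Longrightarrow> \<pi> $$ (i, j) = \<eta> j (\<omega> i)"
  shows "divergence scale lact (calculus_ract lact n \<omega> \<eta> \<sigma>) (calculus_d lact n \<omega> D)
           (\<lambda>f. \<Sum>i<n. D_sigma n D \<pi> \<sigma>b \<sigma>h i (f (\<omega> i)))"
proof -
  interpret projectively_free_calculus scale n D \<sigma> \<sigma>t \<sigma>b \<sigma>h \<pi> lact \<omega> \<eta>
    using assms by (intro projectively_free_calculus.intro projectively_free_calculus_axioms.intro)
  interpret first_order_differential_calculus scale lact ract d
    by (rule is_first_order_differential_calculus)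
  show ?thesis
    unfolding sum_D_sigma
    by standard (simp_all add: row_div_add row_div_scale row_div_right_hom_mult)
qed

end
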